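(* Let $\mathbf{A}$ be a BL-algebra, $\mathbf{B}$ a BL-subalgebra of $\mathbf{A}$ and $c\in A$ such that $(B,c)$ is a $c$-relatively complete subalgebra. Define on $A$ the operations $\forall a:=\max\{b\in B: b\le c\to a\}$ and $\exists a:=\min\{b\in B: c\ast a\le b\}$. Then $\langle\mathbf{A},\forall,\exists\rangle$ is a c-EBL-algebra with focal element $c$, and $\forall A=\exists A=B$. Conversely, if $\langle\mathbf{A},\forall,\exists\rangle$ is a c-EBL-algebra with focal element $c$, then $(\forall A,c)$ is a $c$-relatively complete subalgebra of $\mathbf{A}$.
   Context: A BL-algebra is an algebra $\langle A,\wedge,\vee,\ast,\to,0,1\rangle$ such that $\langle A,\wedge,\vee,0,1\rangle$ is a bounded lattice (order $\le$), $\langle A,\ast,1\rangle$ is a commutative monoid, $a\ast b\le c$ iff $a\le b\to c$, and $a\wedge b=a\ast(a\to b)$ and $(a\to b)\vee(b\to a)=1$ hold; $c^2:=c\ast c$. An Epistemic BL-algebra (EBL-algebra) is a BL-algebra with unary operations $\forall,\exists$ satisfying, for all $a,b$: $\forall 1=1$; $\exists 0=0$; $\forall a\to\exists a=1$; $\forall(a\to\forall b)=\exists a\to\forall b$; $\forall(\forall a\to b)=\forall a\to\forall b$; $\exists a\to\forall\exists a=1$; $\forall(a\wedge b)=\forall a\wedge\forall b$; $\exists(a\vee b)=\exists a\vee\exists b$; $\exists(a\ast\exists b)=\exists a\ast\exists b$. If $\{a\in A:\forall a=1\}$ has a least element $c$, it is called the focal element, and the EBL-algebra is then called a c-EBL-algebra.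 For a BL-algebra $\mathbf{A}$, a subalgebra $\mathbf{B}$ and $c\in A$, the pair $(B,c)$ is a $c$-relatively complete subalgebra if (e1) for every $a\in A$ the set $\{b\in B: b\le c\to a\}$ has a greatest element and the set $\{b\in B: c\ast a\le b\}$ has a least element; and (e2) $\{a\in A: c^2\le a\}\cap B=\{1\}$. Here $\forall A=\{\forall a:a\in A\}$, $\exists A=\{\exists a: a\in A\}$. *)

theory Defs
  imports "HOL-Algebra.Group"
begin

text \<open>The monoid operation is \<open>\<otimes>\<close>; its unit \<open>\<one>\<close> is also the top of the lattice.\<close>

record 'a bl_struct = "'a monoid" +
  bl_meet :: "['a, 'a] \<Rightarrow> 'a" (infixl \<open>\<curlywedge>\<index>\<close> 70)
  bl_join :: "['a, 'a] \<Rightarrow> 'a" (infixl \<open>\<curlyvee>\<index>\<close> 65)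
  bl_imp :: "['a, 'a] \<Rightarrow> 'a" (infixr \<open>\<leadsto>\<index>\<close> 60)
  bl_zero :: 'a (\<open>\<zero>\<index>\<close>)

definition bl_order :: "('a, 'm) bl_struct_scheme \<Rightarrow> 'a gorder"
  where "bl_order L = \<lparr>carrier = carrier L, eq = (=), le = (\<lambda>x y. x \<curlywedge>\<^bsub>L\<^esub> y = x)\<rparr>"

abbreviation bl_le :: "('a, 'm) bl_struct_scheme \<Rightarrow> 'a \<Rightarrow> 'a \<Rightarrow> bool" (infixl \<open>\<preceq>\<index>\<close> 50)
  where "x \<preceq>\<^bsub>L\<^esub> y \<equiv> x \<sqsubseteq>\<^bsub>bl_order L\<^esub> y"

locale bl_algebra = comm_monoid L for L (structure) +
  assumes meet_closed: "\<lbrakk>a \<in> carrier L; b \<in> carrier L\<rbrakk> \<Longrightarrow> a \<curlywedge> b \<in> carrier L"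
    and join_closed: "\<lbrakk>a \<in> carrier L; b \<in> carrier L\<rbrakk> \<Longrightarrow> a \<curlyvee> b \<in> carrier L"
    and imp_closed: "\<lbrakk>a \<in> carrier L; b \<in> carrier L\<rbrakk> \<Longrightarrow> a \<leadsto> b \<in> carrier L"
    and zero_closed: "\<zero> \<in> carrier L"
    and meet_comm: "\<lbrakk>a \<in> carrier L; b \<in> carrier L\<rbrakk> \<Longrightarrow> a \<curlywedge> b = b \<curlywedge> a"
    and join_comm: "\<lbrakk>a \<in> carrier L; b \<in> carrier L\<rbrakk> \<Longrightarrow> a \<curlyvee> b = b \<curlyvee> a"
    and meet_assoc: "\<lbrakk>a \<in> carrier L; b \<in> carrier L; d \<in> carrier L\<rbrakk>
      \<Longrightarrow> (a \<curlywedge> b) \<curlywedge> d = a \<curlywedge> (b \<curlywedge> d)"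
    and join_assoc: "\<lbrakk>a \<in> carrier L; b \<in> carrier L; d \<in> carrier L\<rbrakk>
      \<Longrightarrow> (a \<curlyvee> b) \<curlyvee> d = a \<curlyvee> (b \<curlyvee> d)"
    and meet_absorb: "\<lbrakk>a \<in> carrier L; b \<in> carrier L\<rbrakk> \<Longrightarrow> a \<curlywedge> (a \<curlyvee> b) = a"
    and join_absorb: "\<lbrakk>a \<in> carrier L; b \<in> carrier L\<rbrakk> \<Longrightarrow> a \<curlyvee> (a \<curlywedge> b) = a"
    and zero_least: "a \<in> carrier L \<Longrightarrow> \<zero> \<preceq> a"
    and one_greatest: "a \<in> carrier L \<Longrightarrow> a \<preceq> \<one>"
    and residuation: "\<lbrakk>a \<in> carrier L; b \<in> carrier L; d \<in> carrier L\<rbrakk>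
      \<Longrightarrow> a \<otimes> b \<preceq> d \<longleftrightarrow> a \<preceq> b \<leadsto> d"
    and divisibility: "\<lbrakk>a \<in> carrier L; b \<in> carrier L\<rbrakk> \<Longrightarrow> a \<curlywedge> b = a \<otimes> (a \<leadsto> b)"
    and prelinearity: "\<lbrakk>a \<in> carrier L; b \<in> carrier L\<rbrakk> \<Longrightarrow> (a \<leadsto> b) \<curlyvee> (b \<leadsto> a) = \<one>"

locale bl_subalgebra =
  fixes B and L (structure)
  assumes subset: "B \<subseteq> carrier L"
    and zero_mem: "\<zero> \<in> B"
    and one_mem: "\<one> \<in> B"
    and meet_mem: "\<lbrakk>a \<in> B; b \<in> B\<rbrakk> \<Longrightarrow> a \<curlywedge> b \<in> B"
    and join_mem: "\<lbrakk>a \<in> B; b \<in> B\<rbrakk> \<Longrightarrow> a \<curlyvee> b \<in> B"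
    and mult_mem: "\<lbrakk>a \<in> B; b \<in> B\<rbrakk> \<Longrightarrow> a \<otimes> b \<in> B"
    and imp_mem: "\<lbrakk>a \<in> B; b \<in> B\<rbrakk> \<Longrightarrow> a \<leadsto> b \<in> B"

locale ebl_algebra = bl_algebra L for L (structure) +
  fixes fa ex :: "'a \<Rightarrow> 'a"
  assumes fa_closed: "a \<in> carrier L \<Longrightarrow> fa a \<in> carrier L"
    and ex_closed: "a \<in> carrier L \<Longrightarrow> ex a \<in> carrier L"
    and fa_one: "fa \<one> = \<one>"
    and ex_zero: "ex \<zero> = \<zero>"
    and fa_imp_ex: "a \<in> carrier L \<Longrightarrow> fa a \<leadsto> ex a = \<one>"
    and fa_imp_fa: "\<lbrakk>a \<in> carrier L; b \<in> carrier L\<rbrakk> \<Longrightarrow> fa (a \<leadsto> fa b) = ex a \<leadsto> fa b"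
    and fa_fa_imp: "\<lbrakk>a \<in> carrier L; b \<in> carrier L\<rbrakk> \<Longrightarrow> fa (fa a \<leadsto> b) = fa a \<leadsto> fa b"
    and ex_imp_fa_ex: "a \<in> carrier L \<Longrightarrow> ex a \<leadsto> fa (ex a) = \<one>"
    and fa_meet: "\<lbrakk>a \<in> carrier L; b \<in> carrier L\<rbrakk> \<Longrightarrow> fa (a \<curlywedge> b) = fa a \<curlywedge> fa b"
    and ex_join: "\<lbrakk>a \<in> carrier L; b \<in> carrier L\<rbrakk> \<Longrightarrow> ex (a \<curlyvee> b) = ex a \<curlyvee> ex b"
    and ex_mult_ex: "\<lbrakk>a \<in> carrier L; b \<in> carrier L\<rbrakk> \<Longrightarrow> ex (a \<otimes> ex b) = ex a \<otimes> ex b"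

definition focal_element :: "('a, 'm) bl_struct_scheme \<Rightarrow> ('a \<Rightarrow> 'a) \<Rightarrow> 'a \<Rightarrow> bool"
  where "focal_element L fa c \<longleftrightarrow> least (bl_order L) c {a \<in> carrier L. fa a = \<one>\<^bsub>L\<^esub>}"

locale c_ebl_algebra = ebl_algebra +
  assumes has_focal: "\<exists>c. focal_element L fa c"

locale c_relatively_complete = bl_subalgebra B L for B and L (structure) +
  fixes c
  assumes c_closed: "c \<in> carrier L"
    and e1_greatest: "a \<in> carrier L \<Longrightarrow> \<exists>m. greatest (bl_order L) m {b \<in> B. b \<preceq> c \<leadsto> a}"
    and e1_least: "a \<in> carrier L \<Longrightarrow> \<exists>m. least (bl_order L) m {b \<in> B. c \<otimes> a \<preceq> b}"
    and e2: "{a \<in> carrier L. c \<otimes> c \<preceq> a} \<inter> B = {\<one>}"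

definition rc_forall :: "('a, 'm) bl_struct_scheme \<Rightarrow> 'a set \<Rightarrow> 'a \<Rightarrow> 'a \<Rightarrow> 'a"
  where "rc_forall L B c a =
    (THE m. greatest (bl_order L) m {b \<in> B. b \<preceq>\<^bsub>L\<^esub> c \<leadsto>\<^bsub>L\<^esub> a})"

definition rc_exists :: "('a, 'm) bl_struct_scheme \<Rightarrow> 'a set \<Rightarrow> 'a \<Rightarrow> 'a \<Rightarrow> 'a"
  where "rc_exists L B c a =
    (THE m. least (bl_order L) m {b \<in> B. c \<otimes>\<^bsub>L\<^esub> a \<preceq>\<^bsub>L\<^esub> b})"

end

theory Submission
  imports Defs
begin

text \<open>
  On elements \<open>d\<close> of \<open>B\<close> the two operations are adjoints: \<open>d \<preceq> \<forall>a\<close> iff \<open>d \<otimes> c \<preceq> a\<close>, and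
  \<open>\<exists>a \<preceq> d\<close> iff \<open>c \<otimes> a \<preceq> d\<close>. Since both take values in \<open>B\<close>, every identity of an EBL-algebra
  follows by comparing the elements of \<open>B\<close> below (or above) its two sides; condition (e2) is
  needed only for \<open>\<forall>a \<preceq> \<exists>a\<close> and for \<open>\<forall>\<close>, \<open>\<exists>\<close> to fix \<open>B\<close> pointwise.
  Conversely, in an EBL-algebra the ranges of \<open>\<forall>\<close> and \<open>\<exists>\<close> coincide and consist of common fixed
  points, and \<open>\<forall>a = \<one>\<close> iff \<open>c \<preceq> a\<close>. Applying this equivalence to implications whose one side
  is such a fixed point turns the identities for \<open>\<forall>(a \<leadsto> \<forall>b)\<close> and \<open>\<forall>(\<forall>a \<leadsto> b)\<close> into the
  adjunctions.
\<close>

section \<open>Extremal elements of a subset of a partial order\<close>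

context partial_order
begin

lemma greatest_The:
  assumes "\<exists>m. greatest L m A"
  shows "greatest L (THE m. greatest L m A) A"
proof -
  obtain m where m: "greatest L m A"
    using assms ..
  then show ?thesis
    by (rule theI) (rule greatest_unique[OF _ m])
qed

lemma least_The:
  assumes "\<exists>m. least L m A"
  shows "least L (THE m. least L m A) A"
proof -
  obtain m where m: "least L m A"
    using assms ..
  then show ?thesis
    by (rule theI) (rule least_unique[OF _ m])
qed

lemma greatest_below_iff:
  assumes "B \<subseteq> carrier L" "x \<in> carrier L"
  shows "greatest L m {b \<in> B. b \<sqsubseteq> x} \<longleftrightarrow> m \<in> B \<and> (\<forall>b\<in>B. b \<sqsubseteq> m \<longleftrightarrow> b \<sqsubseteq> x)"
proof -
  have "b \<sqsubseteq> x" if "m \<in> B" "m \<sqsubseteq> x" "b \<in> B" "b \<sqsubseteq> m" for b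
    using that assms le_trans[of b m x] by blast
  moreover have "m \<sqsubseteq> m" if "m \<in> B"
    using that assms by blast
  ultimately show ?thesis
    using assms unfolding greatest_def by blast
qed

lemma least_above_iff:
  assumes "B \<subseteq> carrier L" "x \<in> carrier L"
  shows "least L m {b \<in> B. x \<sqsubseteq> b} \<longleftrightarrow> m \<in> B \<and> (\<forall>b\<in>B. m \<sqsubseteq> b \<longleftrightarrow> x \<sqsubseteq> b)"
proof -
  have "x \<sqsubseteq> b" if "m \<in> B" "x \<sqsubseteq> m" "b \<in> B" "m \<sqsubseteq> b" for b
    using that assms le_trans[of x m b] by blast
  moreover have "m \<sqsubseteq> m" if "m \<in> B"
    using that assms by blast
  ultimately show ?thesis
    using assms unfolding least_def by blast
qed

lemma eq_if_below_iff:
  assumes "B \<subseteq> carrier L" "x \<in> B" "y \<in> B" "\<And>d. d \<in> B \<Longrightarrow> d \<sqsubseteq> x \<longleftrightarrow> d \<sqsubseteq> y"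
  shows "x = y"
  using assms by (metis le_antisym le_refl subsetD)

lemma eq_if_above_iff:
  assumes "B \<subseteq> carrier L" "x \<in> B" "y \<in> B" "\<And>d. d \<in> B \<Longrightarrow> x \<sqsubseteq> d \<longleftrightarrow> y \<sqsubseteq> d"
  shows "x = y"
  using assms by (metis le_antisym le_refl subsetD)

end

section \<open>BL-algebras\<close>

context bl_algebra
begin

declare meet_closed [simp] join_closed [simp] imp_closed [simp] zero_closed [simp]
  one_greatest [simp]

lemma le_iff_meet: "x \<preceq> y \<longleftrightarrow> x \<curlywedge> y = x"
  by (simp add: bl_order_def)

lemma carrier_bl_order [simp]: "carrier (bl_order L) = carrier L"
  by (simp add: bl_order_def)

lemma partial_order_bl_order: "partial_order (bl_order L)"
proof
  show "(.=\<^bsub>bl_order L\<^esub>) = (=)"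
    by (simp add: bl_order_def)
  fix x assume "x \<in> carrier (bl_order L)"
  then show "x \<preceq> x"
    unfolding le_iff_meet by (metis carrier_bl_order join_absorb meet_absorb meet_closed)
next
  fix x y z
  assume "x \<preceq> y" "y \<preceq> z"
    "x \<in> carrier (bl_order L)" "y \<in> carrier (bl_order L)" "z \<in> carrier (bl_order L)"
  then show "x \<preceq> z"
    unfolding le_iff_meet by (metis carrier_bl_order meet_assoc)
qed (auto simp: bl_order_def meet_comm)

sublocale order: partial_order "bl_order L"
  rewrites "carrier (bl_order L) = carrier L"
  by (simp_all add: partial_order_bl_order)

lemma le_iff_join: "\<lbrakk>a \<in> carrier L; b \<in> carrier L\<rbrakk> \<Longrightarrow> a \<preceq> b \<longleftrightarrow> a \<curlyvee> b = b"
  unfolding le_iff_meet by (metis join_absorb join_comm meet_absorb meet_comm)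

lemma meet_le_left: "\<lbrakk>a \<in> carrier L; b \<in> carrier L\<rbrakk> \<Longrightarrow> a \<curlywedge> b \<preceq> a"
  using join_absorb[of a b] by (simp add: le_iff_join join_comm)

lemma le_join_left: "\<lbrakk>a \<in> carrier L; b \<in> carrier L\<rbrakk> \<Longrightarrow> a \<preceq> a \<curlyvee> b"
  by (simp add: le_iff_meet meet_absorb)

lemma le_meet_iff:
  assumes "a \<in> carrier L" "b \<in> carrier L" "d \<in> carrier L"
  shows "d \<preceq> a \<curlywedge> b \<longleftrightarrow> d \<preceq> a \<and> d \<preceq> b"
proof
  assume "d \<preceq> a \<curlywedge> b"
  then show "d \<preceq> a \<and> d \<preceq> b"
    using assms meet_le_left[of a b] meet_le_left[of b a] order.le_trans[of d "a \<curlywedge> b"]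
    by (simp add: meet_comm)
next
  assume "d \<preceq> a \<and> d \<preceq> b"
  then show "d \<preceq> a \<curlywedge> b"
    using assms meet_assoc[of d a b] by (simp add: le_iff_meet)
qed

lemma join_le_iff:
  assumes "a \<in> carrier L" "b \<in> carrier L" "d \<in> carrier L"
  shows "a \<curlyvee> b \<preceq> d \<longleftrightarrow> a \<preceq> d \<and> b \<preceq> d"
proof
  assume "a \<curlyvee> b \<preceq> d"
  then show "a \<preceq> d \<and> b \<preceq> d"
    using assms le_join_left[of a b] le_join_left[of b a] order.le_trans[of _ "a \<curlyvee> b" d]
    by (simp add: join_comm)
next
  assume "a \<preceq> d \<and> b \<preceq> d"
  then show "a \<curlyvee> b \<preceq> d"
    using assms join_assoc[of a b d] by (simp add: le_iff_join)
qed

lemma one_le_iff: "a \<in> carrier L \<Longrightarrow> \<one> \<preceq> a \<longleftrightarrow> a = \<one>"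
  using order.le_antisym[of a \<one>] by auto

lemma imp_eq_one_iff: "\<lbrakk>a \<in> carrier L; b \<in> carrier L\<rbrakk> \<Longrightarrow> a \<leadsto> b = \<one> \<longleftrightarrow> a \<preceq> b"
  using residuation[of \<one> a b] by (simp add: one_le_iff)

lemma one_imp: "a \<in> carrier L \<Longrightarrow> \<one> \<leadsto> a = a"
  using divisibility[of \<one> a] one_greatest[of a] by (simp add: le_iff_meet meet_comm)

lemma residuation_commute:
  "\<lbrakk>a \<in> carrier L; b \<in> carrier L; d \<in> carrier L\<rbrakk> \<Longrightarrow> a \<otimes> b \<preceq> d \<longleftrightarrow> b \<preceq> a \<leadsto> d"
  using residuation[of b a d] by (simp add: m_comm)

lemma le_imp_commute:
  "\<lbrakk>a \<in> carrier L; b \<in> carrier L; d \<in> carrier L\<rbrakk> \<Longrightarrow> a \<preceq> b \<leadsto> d \<longleftrightarrow> b \<preceq> a \<leadsto> d"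
  by (metis residuation residuation_commute)

lemma mult_le_right: "\<lbrakk>a \<in> carrier L; b \<in> carrier L\<rbrakk> \<Longrightarrow> a \<otimes> b \<preceq> b"
  using imp_eq_one_iff[of b b] by (simp add: residuation)

lemma mult_le_left: "\<lbrakk>a \<in> carrier L; b \<in> carrier L\<rbrakk> \<Longrightarrow> a \<otimes> b \<preceq> a"
  using mult_le_right[of b a] by (simp add: m_comm)

lemma mult_join_le_iff:
  assumes "a \<in> carrier L" "b \<in> carrier L" "c \<in> carrier L" "d \<in> carrier L"
  shows "c \<otimes> (a \<curlyvee> b) \<preceq> d \<longleftrightarrow> c \<otimes> a \<preceq> d \<and> c \<otimes> b \<preceq> d"
  using assms by (simp add: residuation_commute join_le_iff)

end

section \<open>From relatively complete subalgebras to EBL-algebras\<close>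

locale bl_relatively_complete = bl_algebra L + c_relatively_complete B L c
  for L (structure) and B c
begin

abbreviation fa :: "'a \<Rightarrow> 'a" where "fa \<equiv> rc_forall L B c"
abbreviation ex :: "'a \<Rightarrow> 'a" where "ex \<equiv> rc_exists L B c"

declare c_closed [simp] one_mem [simp] zero_mem [simp]
  meet_mem [simp] join_mem [simp] mult_mem [simp] imp_mem [simp]

lemma mem_carrier [simp]: "b \<in> B \<Longrightarrow> b \<in> carrier L"
  using subset by blast

lemma rc_forall_greatest:
  "a \<in> carrier L \<Longrightarrow> greatest (bl_order L) (fa a) {b \<in> B. b \<preceq> c \<leadsto> a}"
  unfolding rc_forall_def by (intro order.greatest_The e1_greatest)

lemma rc_exists_least:
  "a \<in> carrier L \<Longrightarrow> least (bl_order L) (ex a) {b \<in> B. c \<otimes> a \<preceq> b}"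
  unfolding rc_exists_def by (intro order.least_The e1_least)

lemma rc_forall_mem [simp]: "a \<in> carrier L \<Longrightarrow> fa a \<in> B"
  using greatest_mem[OF rc_forall_greatest] by blast

lemma rc_exists_mem [simp]: "a \<in> carrier L \<Longrightarrow> ex a \<in> B"
  using least_mem[OF rc_exists_least] by blast

lemma le_rc_forall_iff:
  assumes "a \<in> carrier L" "d \<in> B"
  shows "d \<preceq> fa a \<longleftrightarrow> d \<otimes> c \<preceq> a"
  using rc_forall_greatest[of a] assms subset
  by (simp add: order.greatest_below_iff residuation)

lemma rc_exists_le_iff:
  assumes "a \<in> carrier L" "d \<in> B"
  shows "ex a \<preceq> d \<longleftrightarrow> c \<otimes> a \<preceq> d"
  using rc_exists_least[of a] assms subset by (simp add: order.least_above_iff)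

lemma mult_rc_forall_le: "a \<in> carrier L \<Longrightarrow> c \<otimes> fa a \<preceq> a"
  using le_rc_forall_iff[of a "fa a"] by (simp add: m_comm)

lemma mult_le_rc_exists: "a \<in> carrier L \<Longrightarrow> c \<otimes> a \<preceq> ex a"
  using rc_exists_le_iff[of a "ex a"] by simp

lemma le_if_square_mult_le:
  assumes "x \<in> B" "y \<in> B" "(c \<otimes> c) \<otimes> x \<preceq> y"
  shows "x \<preceq> y"
proof -
  have "x \<leadsto> y \<in> {a \<in> carrier L. c \<otimes> c \<preceq> a} \<inter> B"
    using assms by (simp add: residuation[symmetric])
  then have "x \<leadsto> y = \<one>"
    using e2 by blast
  then show ?thesis
    using assms by (simp add: imp_eq_one_iff)
qed

lemma le_if_mult_le:
  assumes "x \<in> B" "y \<in> B" "c \<otimes> x \<preceq> y"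
  shows "x \<preceq> y"
proof (rule le_if_square_mult_le)
  have "c \<otimes> (c \<otimes> x) \<preceq> c \<otimes> x"
    using assms by (simp add: mult_le_right)
  then show "(c \<otimes> c) \<otimes> x \<preceq> y"
    using assms order.le_trans[of "c \<otimes> (c \<otimes> x)" "c \<otimes> x" y] by (simp add: m_assoc)
qed (fact assms)+

lemma rc_forall_fixed: "b \<in> B \<Longrightarrow> fa b = b"
  by (rule order.le_antisym)
    (simp_all add: le_if_mult_le mult_rc_forall_le le_rc_forall_iff mult_le_left)

lemma rc_exists_fixed: "b \<in> B \<Longrightarrow> ex b = b"
  by (rule order.le_antisym)
    (simp_all add: le_if_mult_le mult_le_rc_exists rc_exists_le_iff mult_le_right)

lemma rc_forall_image: "fa ` carrier L = B"
proof
  show "B \<subseteq> fa ` carrier L"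
    by (metis rc_forall_fixed image_eqI mem_carrier subsetI)
qed auto

lemma rc_exists_image: "ex ` carrier L = B"
proof
  show "B \<subseteq> ex ` carrier L"
    by (metis rc_exists_fixed image_eqI mem_carrier subsetI)
qed auto

lemma rc_forall_le_rc_exists:
  assumes "a \<in> carrier L"
  shows "fa a \<preceq> ex a"
proof (rule le_if_square_mult_le)
  have "c \<otimes> fa a \<preceq> a"
    using assms by (rule mult_rc_forall_le)
  moreover have "a \<preceq> c \<leadsto> ex a"
    using mult_le_rc_exists[OF assms] assms by (simp add: residuation_commute)
  ultimately have "c \<otimes> fa a \<preceq> c \<leadsto> ex a"
    using assms order.le_trans[of "c \<otimes> fa a" a "c \<leadsto> ex a"] by simp
  then show "(c \<otimes> c) \<otimes> fa a \<preceq> ex a"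
    using assms by (simp add: residuation_commute m_assoc)
qed (use assms in simp_all)

lemma rc_forall_imp_mem:
  assumes "a \<in> carrier L" "b \<in> B"
  shows "fa (a \<leadsto> b) = ex a \<leadsto> b"
proof (rule order.eq_if_below_iff[OF subset])
  fix d assume "d \<in> B"
  note closed = this assms
  have "d \<preceq> fa (a \<leadsto> b) \<longleftrightarrow> d \<otimes> (c \<otimes> a) \<preceq> b"
    using closed by (simp add: le_rc_forall_iff residuation[symmetric] m_assoc)
  also have "\<dots> \<longleftrightarrow> ex a \<preceq> d \<leadsto> b"
    using closed by (simp add: rc_exists_le_iff residuation_commute)
  also have "\<dots> \<longleftrightarrow> d \<preceq> ex a \<leadsto> b"
    using closed by (simp add: le_imp_commute)
  finally show "d \<preceq> fa (a \<leadsto> b) \<longleftrightarrow> d \<preceq> ex a \<leadsto> b" .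
qed (use assms in simp_all)

lemma rc_forall_mem_imp:
  assumes "a \<in> carrier L" "b \<in> B"
  shows "fa (b \<leadsto> a) = b \<leadsto> fa a"
proof (rule order.eq_if_below_iff[OF subset])
  fix d assume "d \<in> B"
  note closed = this assms
  have "d \<preceq> fa (b \<leadsto> a) \<longleftrightarrow> (d \<otimes> b) \<otimes> c \<preceq> a"
    using closed by (simp add: le_rc_forall_iff residuation[symmetric] m_ac)
  also have "\<dots> \<longleftrightarrow> d \<preceq> b \<leadsto> fa a"
    using closed by (simp add: le_rc_forall_iff residuation[symmetric])
  finally show "d \<preceq> fa (b \<leadsto> a) \<longleftrightarrow> d \<preceq> b \<leadsto> fa a" .
qed (use assms in simp_all)

lemma rc_exists_mult_mem:
  assumes "a \<in> carrier L" "b \<in> B"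
  shows "ex (a \<otimes> b) = ex a \<otimes> b"
proof (rule order.eq_if_above_iff[OF subset])
  fix d assume "d \<in> B"
  note closed = this assms
  have "ex (a \<otimes> b) \<preceq> d \<longleftrightarrow> c \<otimes> a \<preceq> b \<leadsto> d"
    using closed by (simp add: rc_exists_le_iff residuation[symmetric] m_assoc)
  also have "\<dots> \<longleftrightarrow> ex a \<otimes> b \<preceq> d"
    using closed by (simp add: rc_exists_le_iff residuation)
  finally show "ex (a \<otimes> b) \<preceq> d \<longleftrightarrow> ex a \<otimes> b \<preceq> d" .
qed (use assms in simp_all)

lemma rc_forall_meet:
  assumes "a \<in> carrier L" "b \<in> carrier L"
  shows "fa (a \<curlywedge> b) = fa a \<curlywedge> fa b"
  using assms
  by (intro order.eq_if_below_iff[OF subset]) (simp_all add: le_meet_iff le_rc_forall_iff)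

lemma rc_exists_join:
  assumes "a \<in> carrier L" "b \<in> carrier L"
  shows "ex (a \<curlyvee> b) = ex a \<curlyvee> ex b"
  using assms
  by (intro order.eq_if_above_iff[OF subset])
    (simp_all add: join_le_iff rc_exists_le_iff mult_join_le_iff)

lemma rc_forall_eq_one_iff: "a \<in> carrier L \<Longrightarrow> fa a = \<one> \<longleftrightarrow> c \<preceq> a"
  using le_rc_forall_iff[of a \<one>] by (simp add: one_le_iff)

lemma focal_element_rc_forall: "focal_element L fa c"
  unfolding focal_element_def least_def by (auto simp: rc_forall_eq_one_iff)

lemma c_ebl_algebra_rc_forall_rc_exists: "c_ebl_algebra L fa ex"
proof unfold_locales
  show "\<exists>d. focal_element L fa d"
    using focal_element_rc_forall ..
qed (simp_all add: rc_forall_fixed rc_exists_fixed rc_forall_imp_mem rc_forall_mem_imp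
      rc_exists_mult_mem rc_forall_meet rc_exists_join imp_eq_one_iff rc_forall_le_rc_exists)

end

section \<open>From EBL-algebras to relatively complete subalgebras\<close>

context ebl_algebra
begin

declare fa_closed [simp] ex_closed [simp]

lemma fa_le_ex: "a \<in> carrier L \<Longrightarrow> fa a \<preceq> ex a"
  using fa_imp_ex[of a] by (simp add: imp_eq_one_iff)

lemma ex_eq_one_if_fa_eq_one: "\<lbrakk>a \<in> carrier L; fa a = \<one>\<rbrakk> \<Longrightarrow> ex a = \<one>"
  using fa_le_ex[of a] by (simp add: one_le_iff)

lemma ex_one: "ex \<one> = \<one>"
  by (simp add: ex_eq_one_if_fa_eq_one fa_one)

lemma fa_fa: "a \<in> carrier L \<Longrightarrow> fa (fa a) = fa a"
  using fa_imp_fa[of \<one> a] by (simp add: ex_one one_imp)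

lemma ex_ex: "a \<in> carrier L \<Longrightarrow> ex (ex a) = ex a"
  using ex_mult_ex[of \<one> a] by (simp add: ex_one)

lemma fa_ex: "a \<in> carrier L \<Longrightarrow> fa (ex a) = ex a"
  using fa_le_ex[of "ex a"] ex_imp_fa_ex[of a]
  by (simp add: ex_ex imp_eq_one_iff order.le_antisym)

lemma ex_fa:
  assumes "a \<in> carrier L"
  shows "ex (fa a) = fa a"
proof (rule order.le_antisym)
  have "ex (fa a) \<leadsto> fa a = fa (fa a \<leadsto> fa a)"
    using assms by (simp add: fa_imp_fa)
  also have "\<dots> = \<one>"
    using assms imp_eq_one_iff[of "fa a" "fa a"] by (simp add: fa_one)
  finally show "ex (fa a) \<preceq> fa a"
    using assms by (simp add: imp_eq_one_iff)
  show "fa a \<preceq> ex (fa a)"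
    using assms fa_le_ex[of "fa a"] by (simp add: fa_fa)
qed (use assms in simp_all)

lemma fa_image_iff_fa_fixed: "b \<in> fa ` carrier L \<longleftrightarrow> b \<in> carrier L \<and> fa b = b"
  by (force simp: fa_fa)

lemma fa_image_iff_ex_fixed: "b \<in> fa ` carrier L \<longleftrightarrow> b \<in> carrier L \<and> ex b = b"
  by (metis fa_ex ex_fa fa_image_iff_fa_fixed)

lemma bl_subalgebra_fa_image: "bl_subalgebra (fa ` carrier L) L"
proof
  fix a b assume a: "a \<in> fa ` carrier L" and b: "b \<in> fa ` carrier L"
  note fa_fixed = a [unfolded fa_image_iff_fa_fixed] b [unfolded fa_image_iff_fa_fixed]
  note ex_fixed = a [unfolded fa_image_iff_ex_fixed] b [unfolded fa_image_iff_ex_fixed]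
  show "a \<curlywedge> b \<in> fa ` carrier L"
    using fa_fixed by (simp add: fa_image_iff_fa_fixed fa_meet)
  show "a \<curlyvee> b \<in> fa ` carrier L"
    using ex_fixed by (simp add: fa_image_iff_ex_fixed ex_join)
  show "a \<otimes> b \<in> fa ` carrier L"
    using ex_fixed ex_mult_ex[of a b] by (simp add: fa_image_iff_ex_fixed)
  show "a \<leadsto> b \<in> fa ` carrier L"
    using fa_fixed fa_fa_imp[of a b] by (simp add: fa_image_iff_fa_fixed)
next
  show "\<zero> \<in> fa ` carrier L"
    by (simp add: fa_image_iff_ex_fixed ex_zero)
  show "\<one> \<in> fa ` carrier L"
    by (simp add: fa_image_iff_fa_fixed fa_one)
qed auto

end

locale focal_ebl_algebra = ebl_algebra +
  fixes c
  assumes focal: "focal_element L fa c"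
begin

sublocale bl_subalgebra "fa ` carrier L" L
  by (rule bl_subalgebra_fa_image)

lemma focal_closed [simp]: "c \<in> carrier L"
  and fa_focal: "fa c = \<one>"
  using focal unfolding focal_element_def least_def by auto

lemma focal_le_iff:
  assumes "a \<in> carrier L"
  shows "c \<preceq> a \<longleftrightarrow> fa a = \<one>"
proof
  assume "c \<preceq> a"
  then have "\<one> = \<one> \<curlywedge> fa a"
    using assms fa_meet[of c a] by (simp add: le_iff_meet fa_focal)
  then have "\<one> \<preceq> fa a"
    by (simp add: le_iff_meet)
  then show "fa a = \<one>"
    using assms by (simp add: one_le_iff)
next
  assume "fa a = \<one>"
  then show "c \<preceq> a"
    using focal assms unfolding focal_element_def least_def by blast
qed

lemma le_fa_iff:
  assumes "a \<in> carrier L" "b \<in> fa ` carrier L"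
  shows "b \<preceq> fa a \<longleftrightarrow> b \<preceq> c \<leadsto> a"
proof -
  have b: "b \<in> carrier L" "fa b = b"
    using assms by (simp_all add: fa_image_iff_fa_fixed)
  have "b \<preceq> c \<leadsto> a \<longleftrightarrow> fa (b \<leadsto> a) = \<one>"
    using assms(1) b by (simp add: le_imp_commute[of b c] focal_le_iff)
  also have "\<dots> \<longleftrightarrow> b \<preceq> fa a"
    using assms(1) b fa_fa_imp[of b a] by (simp add: imp_eq_one_iff)
  finally show ?thesis ..
qed

lemma ex_le_iff:
  assumes "a \<in> carrier L" "b \<in> fa ` carrier L"
  shows "ex a \<preceq> b \<longleftrightarrow> c \<otimes> a \<preceq> b"
proof -
  have b: "b \<in> carrier L" "fa b = b"
    using assms by (simp_all add: fa_image_iff_fa_fixed)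
  have "c \<otimes> a \<preceq> b \<longleftrightarrow> fa (a \<leadsto> b) = \<one>"
    using assms(1) b by (simp add: residuation focal_le_iff)
  also have "\<dots> \<longleftrightarrow> ex a \<preceq> b"
    using assms(1) b fa_imp_fa[of a b] by (simp add: imp_eq_one_iff)
  finally show ?thesis ..
qed

lemma eq_one_if_focal_square_le:
  assumes "b \<in> fa ` carrier L" "c \<otimes> c \<preceq> b"
  shows "b = \<one>"
proof -
  have "b \<in> carrier L"
    using assms(1) subset ..
  moreover have "\<one> \<preceq> b"
    using assms ex_le_iff[of c b] by (simp add: ex_eq_one_if_fa_eq_one fa_focal)
  ultimately show ?thesis
    by (simp add: one_le_iff)
qed

lemma c_relatively_complete_fa_image: "c_relatively_complete (fa ` carrier L) L c"
proof
  fix a assume "a \<in> carrier L"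
  then have "greatest (bl_order L) (fa a) {b \<in> fa ` carrier L. b \<preceq> c \<leadsto> a}"
    using subset by (simp add: order.greatest_below_iff le_fa_iff)
  then show "\<exists>m. greatest (bl_order L) m {b \<in> fa ` carrier L. b \<preceq> c \<leadsto> a}" ..
next
  fix a assume "a \<in> carrier L"
  then have "least (bl_order L) (ex a) {b \<in> fa ` carrier L. c \<otimes> a \<preceq> b}"
    using subset
    by (simp add: order.least_above_iff ex_le_iff fa_image_iff_ex_fixed[of "ex a"] ex_ex)
  then show "\<exists>m. least (bl_order L) m {b \<in> fa ` carrier L. c \<otimes> a \<preceq> b}" ..
next
  have "c \<otimes> c \<preceq> \<one>"
    by simp
  then show "{a \<in> carrier L. c \<otimes> c \<preceq> a} \<inter> fa ` carrier L = {\<one>}"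
    using one_mem one_closed eq_one_if_focal_square_le by blast
qed simp

end

theorem theorem8:
  fixes L :: "('a, 'm) bl_struct_scheme"
  assumes "bl_algebra L"
  shows "(\<forall>B c. c_relatively_complete B L c \<longrightarrow>
            c_ebl_algebra L (rc_forall L B c) (rc_exists L B c) \<and>
            focal_element L (rc_forall L B c) c \<and>
            rc_forall L B c ` carrier L = B \<and>
            rc_exists L B c ` carrier L = B) \<and>
         (\<forall>fa ex c. c_ebl_algebra L fa ex \<and> focal_element L fa c \<longrightarrow>
            c_relatively_complete (fa ` carrier L) L c)"
proof (intro conjI allI impI)
  fix B c assume "c_relatively_complete B L c"
  then interpret bl_relatively_complete L B c
    using assms by (simp add: bl_relatively_complete_def)
  show "c_ebl_algebra L (rc_forall L B c) (rc_exists L B c)"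
    by (rule c_ebl_algebra_rc_forall_rc_exists)
  show "focal_element L (rc_forall L B c) c"
    by (rule focal_element_rc_forall)
  show "rc_forall L B c ` carrier L = B"
    by (rule rc_forall_image)
  show "rc_exists L B c ` carrier L = B"
    by (rule rc_exists_image)
next
  fix fa ex c assume "c_ebl_algebra L fa ex \<and> focal_element L fa c"
  then interpret focal_ebl_algebra L fa ex c
    by (simp add: c_ebl_algebra_def focal_ebl_algebra_def focal_ebl_algebra_axioms_def)
  show "c_relatively_complete (fa ` carrier L) L c"
    by (rule c_relatively_complete_fa_image)
qed

end
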